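(* Let $f$ be an entire function in $\mathbb{C}^n$, let $b\neq 0$ be a complex number and let $k\geq 2$ be an integer. If there exists a polynomial $Q_m(w)=\beta_mw^m+\beta_{m-1}w^{m-1}+\cdots+\beta_0$ of degree $m\geq 1$, with $\beta_0,\dots,\beta_m\in\mathbb{C}$ and $\beta_m\neq 0$, such that $f(z)^k\,Q_m(f(z))\,Df(z)\neq b$ for all $z\in\mathbb{C}^n$, then $f$ is constant.
   Context: The total derivative of $f$ is $Df=\sum_{j=1}^n z_j\,\partial f/\partial z_j$. *)

theory Defs
  imports "HOL-Complex_Analysis.Complex_Analysis"
begin

text \<open>
  Complex differentiability at every point: the Frechet derivative, which
  \<open>has_derivative\<close> only requires to be real linear, is complex linear.
\<close>

definition entire :: "(complex ^ 'n \<Rightarrow> complex) \<Rightarrow> bool" where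
  "entire f \<longleftrightarrow>
     (\<forall>z. \<exists>L. (f has_derivative L) (at z) \<and> (\<forall>c v. L (c *s v) = c * L v))"

definition partial_deriv :: "'n \<Rightarrow> (complex ^ 'n \<Rightarrow> complex) \<Rightarrow> complex ^ 'n \<Rightarrow> complex" where
  "partial_deriv j f z = deriv (\<lambda>w. f (\<chi> i. if i = j then w else z $ i)) (z $ j)"

definition total_deriv :: "(complex ^ 'n \<Rightarrow> complex) \<Rightarrow> complex ^ 'n \<Rightarrow> complex" where
  "total_deriv f z = (\<Sum>j\<in>UNIV. z $ j * partial_deriv j f z)"

end

theory Submission
  imports Defs "HOL-Computational_Algebra.Fundamental_Theorem_Algebra"
begin

text \<open>
  On the line through \<open>z\<close> put \<open>u(s) = f(e\<^sup>s z)\<close>; then \<open>u'(s) = Df(e\<^sup>s z)\<close>, so the entire function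
  \<open>u\<close> satisfies \<open>u\<^sup>k Q(u) u' \<noteq> b\<close>, and it suffices that such a \<open>u\<close> is constant. Moving powers of \<open>w\<close>
  from \<open>Q(w)\<close> into \<open>w\<^sup>k\<close>, assume \<open>Q(0) \<noteq> 0\<close>.

  If \<open>u\<close> has exponential type, then \<open>u\<^sup>k Q(u) u' - b\<close> is zero-free, hence \<open>exp(\<alpha>z + \<beta>)\<close>. At a zero of
  \<open>u\<close> its derivative vanishes because \<open>k \<ge> 2\<close>, which forces \<open>\<alpha> = 0\<close> and then \<open>u\<close> constant; without
  zeros \<open>u = exp(cz + d)\<close> and the value \<open>b\<close> is attained unless \<open>c = 0\<close>.

  Otherwise the spherical derivative of \<open>u\<close> is unbounded (Clunie and Hayman), and a Zalcman-Pang rescaling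
  \<open>v\<^sub>n(\<zeta>) = u(a\<^sub>n + \<sigma>\<^sub>n\<^sup>k\<^sup>+\<^sup>1 \<zeta>) / \<sigma>\<^sub>n\<close> with \<open>\<sigma>\<^sub>n \<longlongrightarrow> 0\<close> has a nonconstant limit \<open>v\<close> of
  exponential type. The scaling preserves the omitted value, so by Hurwitz \<open>v\<^sup>k Q(0) v'\<close> omits a nonzero value,
  contradicting the first case.
\<close>

subsection \<open>Bounded spherical derivative\<close>

text \<open>The Cayley transform \<open>x \<mapsto> (x - A) / (x + cnj A)\<close> with
  \<open>A = L z0\<close> takes the right half-plane to the unit disc and \<open>A\<close> to
  \<open>0\<close>, so Schwarz's lemma applies to \<open>\<phi>\<close>. Its bound on values gives
  Harnack's inequality, its bound on the derivative at \<open>0\<close> the gradient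
  estimate.\<close>

lemma positive_Re_holomorphic_Schwarz:
  assumes "d > 0" and hol: "L holomorphic_on ball z0 d"
    and pos: "\<And>w. w \<in> ball z0 d \<Longrightarrow> Re (L w) > 0"
  shows positive_Re_Harnack: "w \<in> ball z0 d \<Longrightarrow>
      Re (L z0) * (d - norm (w - z0)) \<le> Re (L w) * (d + norm (w - z0))"
    and positive_Re_gradient: "d * norm (deriv L z0) \<le> 2 * Re (L z0)"
proof -
  define A where "A = L z0"
  define h where "h \<zeta> = z0 + of_real d * \<zeta>" for \<zeta> :: complex
  define \<phi> where "\<phi> \<zeta> = (L (h \<zeta>) - A) / (L (h \<zeta>) + cnj A)" for \<zeta>
  have A: "Re A > 0"
    using pos[of z0] \<open>d > 0\<close> by (simp add: A_def)
  have h: "h \<zeta> \<in> ball z0 d" if "norm \<zeta> < 1" for \<zeta>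
    using that \<open>d > 0\<close> by (simp add: h_def dist_norm norm_mult)
  have nz: "L (h \<zeta>) + cnj A \<noteq> 0" if "norm \<zeta> < 1" for \<zeta>
  proof -
    have "Re (L (h \<zeta>) + cnj A) > 0"
      using pos[OF h[OF that]] A by simp
    then show ?thesis by force
  qed
  have holLh: "(\<lambda>\<zeta>. L (h \<zeta>)) holomorphic_on ball 0 1"
  proof -
    have "(L \<circ> h) holomorphic_on ball 0 1"
      by (rule holomorphic_on_compose_gen[OF _ hol])
         (use h in \<open>auto simp: h_def[abs_def] intro!: holomorphic_intros\<close>)
    then show ?thesis by (simp add: o_def)
  qed
  have hol\<phi>: "\<phi> holomorphic_on ball 0 1"
    unfolding \<phi>_def using nz by (intro holomorphic_intros holLh) auto
  have \<phi>0: "\<phi> 0 = 0" by (simp add: \<phi>_def h_def A_def)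
  have bound: "norm (\<phi> \<zeta>) < 1" if "norm \<zeta> < 1" for \<zeta>
  proof -
    let ?x = "L (h \<zeta>)"
    have "Re ?x > 0" using pos[OF h[OF that]] .
    then have "Re ?x * Re A > 0" using A by simp
    \<comment> \<open>The two sides differ by \<open>4 * Re ?x * Re A\<close>.\<close>
    then have "(Re ?x - Re A)^2 + (Im ?x - Im A)^2 < (Re ?x + Re A)^2 + (Im ?x - Im A)^2"
      by (simp add: power2_eq_square algebra_simps)
    then have "(norm (?x - A))^2 < (norm (?x + cnj A))^2"
      by (simp add: cmod_power2)
    then have "norm (?x - A) < norm (?x + cnj A)"
      by (simp add: power_less_imp_less_base)
    then show ?thesis using nz[OF that] by (simp add: \<phi>_def norm_divide divide_less_eq)
  qed
  show "Re (L z0) * (d - norm (w - z0)) \<le> Re (L w) * (d + norm (w - z0))" if w: "w \<in> ball z0 d"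
  proof -
    define \<zeta> where "\<zeta> = (w - z0) / of_real d"
    define r where "r = norm \<zeta>"
    have wd: "norm (w - z0) = r * d" using \<open>d > 0\<close> by (simp add: r_def \<zeta>_def norm_divide)
    have r: "0 \<le> r" "r < 1" using w \<open>d > 0\<close> by (auto simp: r_def \<zeta>_def norm_divide dist_norm norm_minus_commute)
    have hw: "h \<zeta> = w" using \<open>d > 0\<close> by (simp add: h_def \<zeta>_def)
    have "norm (\<phi> \<zeta>) \<le> r"
      unfolding r_def by (rule Schwarz_Lemma(1)[OF hol\<phi> \<phi>0 bound]) (use r in \<open>auto simp: r_def\<close>)
    then have "norm (L w - A) \<le> r * norm (L w + cnj A)"
      using nz[of \<zeta>] r by (simp add: \<phi>_def hw norm_divide divide_le_eq flip: r_def)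
    then have "(norm (L w - A))^2 \<le> (r * norm (L w + cnj A))^2"
      by (rule power_mono) simp
    then have "(Re (L w) - Re A)^2 + (Im (L w) - Im A)^2 \<le>
        r^2 * (Re (L w) + Re A)^2 + r^2 * (Im (L w) - Im A)^2"
      by (simp only: cmod_power2 power_mult_distrib distrib_left complex_cnj minus_complex.sel plus_complex.sel cnj.sel) simp
    \<comment> \<open>As \<open>r < 1\<close>, the imaginary parts can be cancelled, which leaves a
      comparison of real squares.\<close>
    moreover have "r^2 * (Im (L w) - Im A)^2 \<le> 1 * (Im (L w) - Im A)^2"
      using r by (intro mult_right_mono) (auto simp: power_le_one)
    ultimately have "(Re A - Re (L w))^2 \<le> (r * (Re (L w) + Re A))^2"
      by (simp add: power_mult_distrib power2_commute)
    then have "Re A - Re (L w) \<le> r * (Re (L w) + Re A)"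
      by (rule power2_le_imp_le) (use r(1) pos[OF w] A in simp)
    then have "d * (Re A * (1 - r)) \<le> d * (Re (L w) * (1 + r))"
      using \<open>d > 0\<close> by (intro mult_left_mono) (auto simp: algebra_simps)
    then show ?thesis by (simp add: A_def wd algebra_simps)
  qed
  have Lder: "(L has_field_derivative deriv L z0) (at (h 0))"
    using hol \<open>d > 0\<close> by (auto simp: h_def intro: holomorphic_derivI)
  have "((\<lambda>\<zeta>. L (h \<zeta>)) has_field_derivative deriv L z0 * of_real d) (at 0)"
    by (rule DERIV_chain2[where f = L and g = h, OF Lder]) (auto simp: h_def[abs_def] intro!: derivative_eq_intros)
  \<comment> \<open>The numerator of \<open>\<phi>\<close> vanishes at \<open>0\<close>, so only one
    term of the quotient rule survives.\<close>
  then have "(\<phi> has_field_derivative deriv L z0 * of_real d / (A + cnj A)) (at 0)"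
    unfolding \<phi>_def using nz[of 0]
    by (auto intro!: derivative_eq_intros simp: A_def h_def)
  then have "deriv \<phi> 0 = deriv L z0 * of_real d / (A + cnj A)"
    by (rule DERIV_imp_deriv)
  moreover have "norm (deriv \<phi> 0) \<le> 1"
    by (rule Schwarz_Lemma(2)[OF hol\<phi> \<phi>0 bound, of 0]) auto
  moreover have "norm (A + cnj A) = 2 * Re A"
    using A by (simp add: complex_add_cnj norm_mult)
  ultimately have "norm (deriv L z0) * d / (2 * Re A) \<le> 1"
    using \<open>d > 0\<close> by (simp add: norm_divide norm_mult)
  then show "d * norm (deriv L z0) \<le> 2 * Re (L z0)"
    using A by (simp add: A_def mult.commute)
qed

section \<open>Growth estimates from a bound on the spherical derivative\<close>

text \<open>Hopf's boundary point lemma for the positive harmonic function \<open>ln (\<bar>v\<bar> / M)\<close>.\<close>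

lemma ln_norm_le_at_touching_point:
  fixes v :: "complex \<Rightarrow> complex"
  assumes hol: "v holomorphic_on UNIV" and "M \<ge> 1" "C \<ge> 0"
    and d: "d = dist z z1" "d > 0"
    and out: "\<And>w. w \<in> ball z d \<Longrightarrow> norm (v w) > M"
    and z1: "norm (v z1) \<le> M" "norm (deriv v z1) \<le> C * (1 + (norm (v z1))\<^sup>2)"
  shows "ln (norm (v z) / M) \<le> 4 * C * M * d"
proof -
  have "v w \<noteq> 0" if "w \<in> ball z d" for w
    using out[OF that] \<open>M \<ge> 1\<close> by auto
  then obtain L where L: "L holomorphic_on ball z d" "\<And>w. w \<in> ball z d \<Longrightarrow> exp (L w) = v w"
    using holomorphic_logarithm_exists[OF convex_ball open_ball holomorphic_on_subset[OF hol subset_UNIV], of z d z] d(2)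
    by auto
  define L1 where "L1 w = L w - of_real (ln M)" for w
  have ReL1: "Re (L1 w) = ln (norm (v w) / M)" if "w \<in> ball z d" for w
  proof -
    have "norm (v w) = exp (Re (L w))" using L(2)[OF that] by (metis norm_exp_eq_Re)
    then show ?thesis using \<open>M \<ge> 1\<close> by (simp add: L1_def ln_div)
  qed
  have pos: "Re (L1 w) > 0" if "w \<in> ball z d" for w
    using out[OF that] \<open>M \<ge> 1\<close> unfolding ReL1[OF that] by (intro ln_gt_zero) simp
  have holL1: "L1 holomorphic_on ball z d"
    unfolding L1_def by (intro holomorphic_intros L)
  define K where "K = ln (norm (v z) / M)"
  \<comment> \<open>\<open>w t\<close> runs along the radius from the touching point
    \<open>z1\<close> (\<open>t = 0\<close>) to the centre \<open>z\<close> (\<open>t = 1\<close>).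
    By Harnack \<open>Re L1\<close> grows at least linearly in \<open>t\<close>, and the difference
    quotient \<open>q\<close> limits that growth; \<open>t \<longlonglongrightarrow> 0\<close>
    replaces \<open>q\<close> by \<open>deriv v z1\<close>.\<close>
  define w where "w t = z1 + of_real t * (z - z1)" for t :: real
  define q where "q x = (v x - v z1) / (x - z1)" for x
  have *: "K \<le> 2 * d * norm (q (w t)) / M" if t: "0 < t" "t < 1" for t
  proof -
    have "w t - z = of_real (1 - t) * (z1 - z)" by (simp add: w_def algebra_simps)
    then have wz: "norm (w t - z) = (1 - t) * d"
      using t by (simp only: norm_mult norm_of_real) (simp add: d dist_norm norm_minus_commute)
    have wz1: "norm (w t - z1) = t * d"
      using t by (simp add: w_def norm_mult d dist_norm)
    have inb: "w t \<in> ball z d"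
      using t d(2) wz by (simp add: dist_norm norm_minus_commute)
    have "Re (L1 z) * (d - norm (w t - z)) \<le> Re (L1 (w t)) * (d + norm (w t - z))"
      by (rule positive_Re_Harnack[OF d(2) holL1 pos inb])
    also have "\<dots> \<le> Re (L1 (w t)) * (2 * d)"
      using pos[OF inb] t d(2) by (intro mult_left_mono) (auto simp: wz)
    finally have "K * (t * d) \<le> Re (L1 (w t)) * (2 * d)"
      using d(2) by (simp add: ReL1 wz K_def algebra_simps)
    \<comment> \<open>Here \<open>ln x \<le> x - 1\<close> removes the logarithm, and
      \<open>norm (v z1) \<le> M\<close> then brings in the increment of \<open>v\<close>.\<close>
    also have "Re (L1 (w t)) \<le> norm (v (w t)) / M - 1"
      unfolding ReL1[OF inb] using out[OF inb] \<open>M \<ge> 1\<close>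
      by (intro ln_le_minus_one divide_pos_pos) linarith+
    also have "\<dots> \<le> norm (v (w t) - v z1) / M"
    proof -
      have "norm (v (w t)) / M - 1 = (norm (v (w t)) - M) / M"
        using \<open>M \<ge> 1\<close> by (simp add: diff_divide_distrib)
      also have "\<dots> \<le> norm (v (w t) - v z1) / M"
        using z1(1) \<open>M \<ge> 1\<close> norm_triangle_ineq2[of "v (w t)" "v z1"]
        by (intro divide_right_mono) auto
      finally show ?thesis .
    qed
    also have "norm (v (w t) - v z1) = norm (q (w t)) * (t * d)"
    proof -
      have "w t - z1 \<noteq> 0" using wz1 t d(2) by auto
      then show ?thesis by (simp add: q_def norm_divide flip: wz1)
    qed
    finally have "K * (t * d) \<le> (2 * d * norm (q (w t)) / M) * (t * d)"
      using d(2) by (simp add: algebra_simps)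
    then show ?thesis
      by (rule mult_right_le_imp_le) (use t d(2) in simp)
  qed
  have "(v has_field_derivative deriv v z1) (at z1)"
    using hol by (auto intro: holomorphic_derivI)
  then have "(q \<longlongrightarrow> deriv v z1) (at z1)"
    unfolding q_def has_field_derivative_iff .
  moreover have "filterlim w (at z1) (at_right 0)"
  proof (rule filterlim_atI)
    have "(w \<longlongrightarrow> z1 + of_real 0 * (z - z1)) (at_right 0)"
      unfolding w_def by (intro tendsto_intros)
    then show "(w \<longlongrightarrow> z1) (at_right 0)" by simp
    show "\<forall>\<^sub>F t in at_right 0. w t \<noteq> z1"
      using d by (auto simp: eventually_at_right_less w_def intro: eventually_mono[OF eventually_at_right_less])
  qed
  ultimately have "((\<lambda>t. q (w t)) \<longlongrightarrow> deriv v z1) (at_right 0)"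
    by (rule filterlim_compose)
  then have "((\<lambda>t. 2 * d * norm (q (w t)) / M) \<longlongrightarrow> 2 * d * norm (deriv v z1) / M) (at_right 0)"
    using \<open>M \<ge> 1\<close> by (intro tendsto_intros) auto
  then have "K \<le> 2 * d * norm (deriv v z1) / M"
  proof (rule tendsto_lowerbound)
    show "\<forall>\<^sub>F t in at_right 0. K \<le> 2 * d * norm (q (w t)) / M"
      using eventually_at_right_real[OF zero_less_one] by eventually_elim (use * in auto)
  qed auto
  \<comment> \<open>Both \<open>1\<close> and \<open>(norm (v z1))\<^sup>2\<close> are at most
    \<open>M\<^sup>2\<close>, hence the factor \<open>2 * M\<^sup>2\<close>.\<close>
  also have "\<dots> \<le> 2 * d * (2 * C * M\<^sup>2) / M"
  proof -
    have "(norm (v z1))\<^sup>2 \<le> M\<^sup>2" using z1 by (intro power_mono) auto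
    moreover have "1 \<le> M\<^sup>2" using \<open>M \<ge> 1\<close> by simp
    ultimately have "C * (1 + (norm (v z1))\<^sup>2) \<le> C * (2 * M\<^sup>2)"
      using \<open>C \<ge> 0\<close> by (intro mult_left_mono) auto
    then have "norm (deriv v z1) \<le> 2 * C * M\<^sup>2" using z1(2) by simp
    then show ?thesis using d(2) \<open>M \<ge> 1\<close>
      by (intro divide_right_mono mult_left_mono) auto
  qed
  also have "\<dots> = 4 * C * M * d"
    using \<open>M \<ge> 1\<close> by (simp add: power2_eq_square)
  finally show ?thesis by (simp add: K_def)
qed

text \<open>The set where \<open>norm v \<le> M\<close> is closed and contains \<open>x\<close>, so
  its distance from \<open>z\<close> is attained; minimality keeps the open ball up to
  \<open>z1\<close> outside the set.\<close>

lemma nearest_point_small_norm: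
  fixes v :: "complex \<Rightarrow> complex"
  assumes cont: "continuous_on UNIV v" and x: "norm (v x) \<le> M"
  obtains z1 where "norm (v z1) \<le> M" "dist z z1 \<le> dist z x"
    "\<And>w. w \<in> ball z (dist z z1) \<Longrightarrow> norm (v w) > M"
proof -
  have "closed {w. norm (v w) \<le> M}"
    by (intro closed_Collect_le continuous_intros cont)
  moreover have "{w. norm (v w) \<le> M} \<noteq> {}" using x by auto
  ultimately obtain z1 where "z1 \<in> {w. norm (v w) \<le> M}"
      "\<And>w. w \<in> {w. norm (v w) \<le> M} \<Longrightarrow> dist z z1 \<le> dist z w"
    using distance_attains_inf[of "{w. norm (v w) \<le> M}" z] by blast
  then show ?thesis using that x by (metis linorder_not_less mem_Collect_eq mem_ball)
qed

text \<open>Clunie and Hayman: apply the previous bound at the point of \<open>{\<bar>v\<bar> \<le> M}\<close> nearest to \<open>z\<close>.\<close>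

lemma spherical_derivative_bound_imp_exponential_growth:
  fixes v :: "complex \<Rightarrow> complex"
  assumes hol: "v holomorphic_on UNIV" and M: "M \<ge> 1" "norm (v 0) \<le> M" and "C \<ge> 0"
    and der: "\<And>z. norm z \<le> 2 * R \<Longrightarrow> norm (deriv v z) \<le> C * (1 + (norm (v z))\<^sup>2)"
    and z: "norm z \<le> R"
  shows "norm (v z) \<le> M * exp (4 * C * M * norm z)"
proof (cases "norm (v z) \<le> M")
  case True
  also have "M \<le> M * exp (4 * C * M * norm z)"
    using M \<open>C \<ge> 0\<close> by simp
  finally show ?thesis .
next
  case False
  obtain z1 where z1: "norm (v z1) \<le> M" "dist z z1 \<le> dist z 0"
    "\<And>w. w \<in> ball z (dist z z1) \<Longrightarrow> norm (v w) > M"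
    using nearest_point_small_norm[OF holomorphic_on_imp_continuous_on[OF hol] M(2)] by blast
  \<comment> \<open>The origin lies in the set where \<open>norm v \<le> M\<close>, so
    \<open>z1\<close> is no farther from \<open>z\<close> than \<open>0\<close> is. This is why the
    derivative bound is assumed up to radius \<open>2 * R\<close>.\<close>
  have "norm z1 \<le> norm z + dist z z1"
    using norm_triangle_sub[of z1 z] by (simp add: dist_norm norm_minus_commute)
  then have "norm (deriv v z1) \<le> C * (1 + (norm (v z1))\<^sup>2)"
    using z z1(2) by (intro der) auto
  moreover have "dist z z1 > 0" using False z1(1) by auto
  ultimately have "ln (norm (v z) / M) \<le> 4 * C * M * dist z z1"
    using ln_norm_le_at_touching_point[OF hol M(1) \<open>C \<ge> 0\<close> refl _ z1(3) z1(1)] by blast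
  also have "\<dots> \<le> 4 * C * M * norm z"
    using z1(2) M \<open>C \<ge> 0\<close> by (intro mult_left_mono) auto
  finally have "exp (ln (norm (v z) / M)) \<le> exp (4 * C * M * norm z)"
    by simp
  moreover have "norm (v z) / M > 0"
    using False M by (intro divide_pos_pos) linarith+
  ultimately have "norm (v z) / M \<le> exp (4 * C * M * norm z)"
    by simp
  then show ?thesis using M by (simp add: field_simps)
qed

text \<open>This keeps the rescaled functions bounded at \<open>0\<close>. If
  \<open>norm (v 0)\<close> were large, \<open>ln (norm v)\<close> would be positive on a disc
  around \<open>0\<close>; the gradient estimate there, combined with the boundary bound at the
  nearest point where \<open>norm v \<le> 1\<close>, would make \<open>deriv v 0\<close> too small
  for \<open>lower\<close>.\<close>

lemma spherical_derivative_ge_1_imp_bounded: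
  fixes v :: "complex \<Rightarrow> complex"
  assumes hol: "v holomorphic_on UNIV" and "C \<ge> 0"
    and der: "\<And>z. norm z \<le> 2 \<Longrightarrow> norm (deriv v z) \<le> C * (1 + (norm (v z))\<^sup>2)"
    and lower: "1 + (norm (v 0))\<^sup>2 \<le> norm (deriv v 0)"
  shows "norm (v 0) \<le> max 1 (8 * C)"
proof (rule ccontr)
  assume "\<not> ?thesis"
  then have v0: "norm (v 0) > 1" "norm (v 0) > 8 * C" by auto
  \<comment> \<open>Gradient estimate for a logarithm \<open>L\<close> of \<open>v\<close>, whose
    real part \<open>ln (norm v)\<close> is positive on the disc;
    \<open>deriv v 0 = v 0 * deriv L 0\<close> carries it over to \<open>v\<close>.\<close>
  have grad: "d * norm (deriv v 0) \<le> 2 * norm (v 0) * ln (norm (v 0))"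
    if "d > 0" and out: "\<And>w. w \<in> ball 0 d \<Longrightarrow> norm (v w) > 1" for d
  proof -
    have "v w \<noteq> 0" if "w \<in> ball 0 d" for w
      using out[OF that] by auto
    then obtain L where L: "L holomorphic_on ball 0 d" "\<And>w. w \<in> ball 0 d \<Longrightarrow> exp (L w) = v w"
      using holomorphic_logarithm_exists[OF convex_ball open_ball holomorphic_on_subset[OF hol subset_UNIV], of 0 d 0] \<open>d > 0\<close>
      by auto
    have ReL: "Re (L w) = ln (norm (v w))" if "w \<in> ball 0 d" for w
      using L(2)[OF that] by (metis norm_exp_eq_Re ln_exp)
    have "d * norm (deriv L 0) \<le> 2 * Re (L 0)"
      using out \<open>d > 0\<close> by (intro positive_Re_gradient[OF _ L(1)]) (auto simp: ReL intro!: ln_gt_zero)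
    moreover have "deriv v 0 = v 0 * deriv L 0"
    proof -
      have "(L has_field_derivative deriv L 0) (at 0)"
        using L(1) \<open>d > 0\<close> by (auto intro: holomorphic_derivI)
      then have "((\<lambda>w. exp (L w)) has_field_derivative exp (L 0) * deriv L 0) (at 0)"
        by (auto intro!: derivative_eq_intros)
      then have "(v has_field_derivative exp (L 0) * deriv L 0) (at 0)"
        by (rule has_field_derivative_transform_within_open[of _ _ _ "ball 0 d"])
           (use L(2) \<open>d > 0\<close> in auto)
      then show ?thesis using L(2)[of 0] \<open>d > 0\<close> by (simp add: DERIV_imp_deriv)
    qed
    ultimately have "norm (v 0) * (d * norm (deriv L 0)) \<le> norm (v 0) * (2 * ln (norm (v 0)))"
      using \<open>d > 0\<close> by (intro mult_left_mono) (auto simp: ReL)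
    with \<open>deriv v 0 = v 0 * deriv L 0\<close> show ?thesis
      by (simp add: norm_mult algebra_simps)
  qed
  show False
  proof (cases "\<exists>x. norm x \<le> 2 \<and> norm (v x) \<le> 1")
    case True
    then obtain x where x: "norm x \<le> 2" "norm (v x) \<le> 1" by blast
    obtain z1 where z1: "norm (v z1) \<le> 1" "dist 0 z1 \<le> dist 0 x"
      "\<And>w. w \<in> ball 0 (dist 0 z1) \<Longrightarrow> norm (v w) > 1"
      using nearest_point_small_norm[OF holomorphic_on_imp_continuous_on[OF hol] x(2)] by blast
    have dpos: "dist 0 z1 > 0" using v0 z1(1) by auto
    have "norm (deriv v z1) \<le> C * (1 + (norm (v z1))\<^sup>2)"
      using x z1(2) by (intro der) auto
    then have "ln (norm (v 0)) \<le> 4 * C * dist 0 z1"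
      using ln_norm_le_at_touching_point[OF hol order_refl \<open>C \<ge> 0\<close> refl dpos z1(3) z1(1)] by simp
    then have "2 * norm (v 0) * ln (norm (v 0)) \<le> 2 * norm (v 0) * (4 * C * dist 0 z1)"
      by (intro mult_left_mono) auto
    with grad[OF dpos z1(3)] have "dist 0 z1 * norm (deriv v 0) \<le> dist 0 z1 * (8 * C * norm (v 0))"
      by (simp add: algebra_simps)
    \<comment> \<open>The radius \<open>dist 0 z1\<close>, over which there is no control from
      below, cancels.\<close>
    then have "norm (deriv v 0) \<le> 8 * C * norm (v 0)" using dpos by simp
    also have "\<dots> \<le> norm (v 0) * norm (v 0)" using v0 by (intro mult_right_mono) auto
    finally show False using lower by (simp add: power2_eq_square)
  next
    case False
    \<comment> \<open>Now the whole disc of radius \<open>2\<close> is available, and the factor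
      \<open>2\<close> in the gradient estimate cancels.\<close>
    then have "norm (v w) > 1" if "w \<in> ball 0 2" for w
      using that by (metis dist_0_norm less_eq_real_def linorder_not_le mem_ball)
    then have "2 * norm (deriv v 0) \<le> 2 * norm (v 0) * ln (norm (v 0))"
      by (intro grad) simp_all
    moreover have "norm (v 0) * ln (norm (v 0)) \<le> norm (v 0) * (norm (v 0) - 1)"
      using v0 by (intro mult_left_mono ln_le_minus_one) auto
    ultimately show False using lower v0 by (simp add: power2_eq_square algebra_simps)
  qed
qed

subsection \<open>Functions of exponential type\<close>

text \<open>A logarithm \<open>p\<close> of \<open>f\<close> has real part of at most linear growth.
  The gradient estimate on ever larger discs bounds \<open>deriv p\<close>, and Liouville's theorem
  makes it constant.\<close>

lemma zero_free_exponential_type: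
  fixes f :: "complex \<Rightarrow> complex"
  assumes hol: "f holomorphic_on UNIV" and nz: "\<And>z. f z \<noteq> 0"
    and bound: "\<And>z. norm (f z) \<le> A * exp (B * norm z)"
  obtains \<alpha> \<beta> where "\<And>z. f z = exp (\<alpha> * z + \<beta>)"
proof -
  obtain p where p: "p holomorphic_on UNIV" "\<And>z. exp (p z) = f z"
    using holomorphic_logarithm_exists[OF convex_UNIV open_UNIV hol, of 0] nz by auto
  have "0 < norm (f 0)" using nz by simp
  also have "\<dots> \<le> A" using bound[of 0] by simp
  finally have "A > 0" .
  \<comment> \<open>\<open>B' \<ge> 0\<close> makes the bound increase with \<open>norm z\<close>;
    the \<open>+ 1\<close> in \<open>A'\<close> makes it strict, as positivity of
    \<open>Re L\<close> below demands.\<close>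
  define B' where "B' = max B 0"
  define A' where "A' = ln A + 1"
  have Re_p: "Re (p z) < A' + B' * norm z" for z
  proof -
    have "exp (Re (p z)) = norm (f z)"
      using p(2)[of z] by (metis norm_exp_eq_Re)
    also have "\<dots> \<le> A * exp (B * norm z)" by (rule bound)
    also have "\<dots> = exp (ln A + B * norm z)"
      using \<open>A > 0\<close> by (simp add: exp_add)
    finally have "Re (p z) \<le> ln A + B * norm z" by simp
    also have "\<dots> \<le> ln A + B' * norm z"
      unfolding B'_def by (intro add_left_mono mult_right_mono) auto
    finally show ?thesis by (simp add: A'_def)
  qed
  have dbound: "norm (deriv p z0) \<le> 2 * B'" for z0
  proof (rule tendsto_lowerbound)
    let ?g = "\<lambda>R. 2 * (A' + B' * norm z0 - Re (p z0)) / R + 2 * B'"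
    show "(?g \<longlongrightarrow> 2 * B') at_top" by real_asymp
    show "\<forall>\<^sub>F R in at_top. norm (deriv p z0) \<le> ?g R"
      using eventually_gt_at_top[of "0 :: real"]
    proof eventually_elim
      case (elim R)
      \<comment> \<open>\<open>L\<close> is an upper bound for \<open>Re p\<close> on the ball,
        minus \<open>p\<close>. Dividing its gradient estimate by \<open>R\<close> gives
        \<open>?g R\<close>, which tends to \<open>2 * B'\<close>.\<close>
      define L where "L w = of_real (A' + B' * (norm z0 + R)) - p w" for w
      have holL: "L holomorphic_on ball z0 R"
        unfolding L_def by (intro holomorphic_intros holomorphic_on_subset[OF p(1)]) auto
      have "Re (L w) > 0" if "w \<in> ball z0 R" for w
      proof -
        have "norm w \<le> norm z0 + R"
          using that norm_triangle_sub[of w z0] by (auto simp: dist_norm norm_minus_commute)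
        then have "B' * norm w \<le> B' * (norm z0 + R)"
          by (intro mult_left_mono) (auto simp: B'_def)
        then show ?thesis using Re_p[of w] by (simp add: L_def)
      qed
      then have "R * norm (deriv L z0) \<le> 2 * Re (L z0)"
        using positive_Re_gradient[OF elim holL] by blast
      moreover have "deriv L z0 = - deriv p z0"
        unfolding L_def using p(1)
        by (intro DERIV_imp_deriv) (auto intro!: derivative_eq_intros holomorphic_derivI)
      ultimately have "R * norm (deriv p z0) \<le> 2 * Re (L z0)" by simp
      then show ?case using elim by (simp add: L_def field_simps)
    qed
  qed auto
  have "deriv p holomorphic_on UNIV"
    by (intro holomorphic_deriv p) auto
  moreover have "bounded (range (deriv p))"
    using dbound by (auto simp: bounded_iff)
  ultimately obtain \<alpha> where \<alpha>: "\<And>z. deriv p z = \<alpha>"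
    using Liouville_theorem[of "deriv p"] by (auto simp: constant_on_def)
  have "((\<lambda>z. p z - \<alpha> * z) has_field_derivative 0) (at z)" for z
    using holomorphic_derivI[OF p(1) open_UNIV, of z] \<alpha>[of z]
    by (auto intro!: derivative_eq_intros)
  then obtain \<beta> where "\<And>z. p z - \<alpha> * z = \<beta>"
    using has_field_derivative_zero_constant[OF convex_UNIV, of "\<lambda>z. p z - \<alpha> * z"] by auto
  then have "p z = \<alpha> * z + \<beta>" for z
    by (simp add: algebra_simps flip: \<open>\<And>z. p z - \<alpha> * z = \<beta>\<close>)
  then show ?thesis using that[of \<alpha> \<beta>] p(2) by metis
qed

section \<open>Closure properties of functions of exponential type\<close>

definition exponential_type :: "(complex \<Rightarrow> complex) \<Rightarrow> bool" where
  "exponential_type f \<longleftrightarrow> (\<exists>A\<ge>0. \<exists>B\<ge>0. \<forall>z. norm (f z) \<le> A * exp (B * norm z))"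

lemma exponential_typeI:
  assumes "\<And>z. norm (f z) \<le> A * exp (B * norm z)"
  shows "exponential_type f"
proof -
  have "norm (f z) \<le> \<bar>A\<bar> * exp (\<bar>B\<bar> * norm z)" for z
  proof -
    have "norm (f z) \<le> A * exp (B * norm z)" by (rule assms)
    also have "\<dots> \<le> \<bar>A\<bar> * exp (\<bar>B\<bar> * norm z)"
      by (intro mult_mono) (auto intro: mult_right_mono)
    finally show ?thesis .
  qed
  then show ?thesis unfolding exponential_type_def by (metis abs_ge_zero)
qed

lemma exponential_type_const: "exponential_type (\<lambda>_. c)"
  by (rule exponential_typeI[where A = "norm c" and B = 0]) simp

lemma exponential_type_add:
  assumes "exponential_type f" "exponential_type g"
  shows "exponential_type (\<lambda>z. f z + g z)"
proof -
  obtain A B A' B' where AB: "A \<ge> 0" "A' \<ge> 0"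
    "\<And>z. norm (f z) \<le> A * exp (B * norm z)" "\<And>z. norm (g z) \<le> A' * exp (B' * norm z)"
    using assms unfolding exponential_type_def by metis
  have "norm (f z + g z) \<le> (A + A') * exp (max B B' * norm z)" for z
  proof -
    have "norm (f z + g z) \<le> A * exp (B * norm z) + A' * exp (B' * norm z)"
      using AB(3,4)[of z] norm_triangle_ineq[of "f z" "g z"] by linarith
    also have "\<dots> \<le> A * exp (max B B' * norm z) + A' * exp (max B B' * norm z)"
      using AB(1,2) by (intro add_mono mult_left_mono) (auto intro: mult_right_mono)
    finally show ?thesis by (simp add: algebra_simps)
  qed
  then show ?thesis by (rule exponential_typeI)
qed

lemma exponential_type_mult:
  assumes "exponential_type f" "exponential_type g"
  shows "exponential_type (\<lambda>z. f z * g z)"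
proof -
  obtain A B A' B' where AB: "A \<ge> 0" "A' \<ge> 0"
    "\<And>z. norm (f z) \<le> A * exp (B * norm z)" "\<And>z. norm (g z) \<le> A' * exp (B' * norm z)"
    using assms unfolding exponential_type_def by metis
  have "norm (f z * g z) \<le> (A * A') * exp ((B + B') * norm z)" for z
  proof -
    have "norm (f z * g z) \<le> (A * exp (B * norm z)) * (A' * exp (B' * norm z))"
      unfolding norm_mult using AB by (intro mult_mono) auto
    then show ?thesis by (simp add: algebra_simps exp_add)
  qed
  then show ?thesis by (rule exponential_typeI)
qed

lemma exponential_type_power:
  "exponential_type f \<Longrightarrow> exponential_type (\<lambda>z. f z ^ n)"
  by (induction n) (auto intro: exponential_type_const exponential_type_mult)

lemma exponential_type_poly:
  "exponential_type f \<Longrightarrow> exponential_type (\<lambda>z. poly W (f z))"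
  by (induction W) (auto intro: exponential_type_const exponential_type_mult exponential_type_add)

text \<open>Cauchy's inequality on the unit circle around \<open>z\<close>, where the argument has
  norm at most \<open>norm z + 1\<close>; this costs a factor \<open>exp B\<close>.\<close>

lemma exponential_type_deriv:
  assumes hol: "f holomorphic_on UNIV" and "exponential_type f"
  shows "exponential_type (deriv f)"
proof -
  obtain A B where AB: "A \<ge> 0" "B \<ge> 0" "\<And>z. norm (f z) \<le> A * exp (B * norm z)"
    using assms unfolding exponential_type_def by metis
  have "norm (deriv f z) \<le> (A * exp B) * exp (B * norm z)" for z
  proof -
    have "norm ((deriv ^^ 1) f z) \<le> fact 1 * (A * exp (B * (norm z + 1))) / 1 ^ 1"
    proof (rule Cauchy_inequality)
      show "f holomorphic_on ball z 1" "continuous_on (cball z 1) f"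
        using hol by (auto intro: holomorphic_on_subset holomorphic_on_imp_continuous_on)
      fix x assume "norm (z - x) = 1"
      then have "norm x \<le> norm z + 1"
        using norm_triangle_sub[of x z] by (simp add: norm_minus_commute)
      then have "A * exp (B * norm x) \<le> A * exp (B * (norm z + 1))"
        using AB by (intro mult_left_mono) (auto intro: mult_left_mono)
      then show "norm (f x) \<le> A * exp (B * (norm z + 1))"
        using AB(3)[of x] by linarith
    qed auto
    then show ?thesis by (simp add: algebra_simps exp_add)
  qed
  then show ?thesis by (rule exponential_typeI)
qed

lemma polynomial_antiderivative_exists:
  fixes p :: "'a::field_char_0 poly"
  obtains P where "pderiv P = p"
proof
  define P where "P = Poly (0 # map (\<lambda>i. coeff p i / of_nat (Suc i)) [0..<Suc (degree p)])"
  show "pderiv P = p"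
  proof (rule poly_eqI)
    fix n
    show "coeff (pderiv P) n = coeff p n"
      by (cases "n \<le> degree p")
         (auto simp: coeff_pderiv P_def nth_default_def coeff_eq_0 nth_append le_Suc_eq
               simp del: of_nat_Suc)
  qed
qed

text \<open>\<open>W\<close> may be constant: the rescaling limit will be treated with
  \<open>[:poly W 0:]\<close>.\<close>

lemma exponential_type_omitting_imp_constant:
  fixes v :: "complex \<Rightarrow> complex"
  assumes hol: "v holomorphic_on UNIV" and type: "exponential_type v"
    and "W \<noteq> 0" "k \<ge> 2" "b \<noteq> 0"
    and omit: "\<And>z. v z ^ k * poly W (v z) * deriv v z \<noteq> b"
  shows "v constant_on UNIV"
proof -
  define U where "U z = v z ^ k * poly W (v z) * deriv v z" for z
  have holv': "deriv v holomorphic_on UNIV"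
    by (intro holomorphic_deriv hol) auto
  have vder: "(v has_field_derivative deriv v z) (at z)" for z
    using hol by (auto intro: holomorphic_derivI)
  have v'der: "(deriv v has_field_derivative deriv (deriv v) z) (at z)" for z
    using holv' by (auto intro: holomorphic_derivI)
  have Wder: "((\<lambda>z. poly W (v z)) has_field_derivative poly (pderiv W) (v z) * deriv v z) (at z)" for z
    by (rule DERIV_chain2[OF poly_DERIV vder])
  have holWv: "(\<lambda>z. poly W (v z)) holomorphic_on UNIV"
    using Wder by (auto simp: holomorphic_on_def field_differentiable_def)
  have holU: "U holomorphic_on UNIV"
    unfolding U_def by (intro holomorphic_intros hol holWv holv')
  have "exponential_type (\<lambda>z. U z + (- b))"
    unfolding U_def
    by (intro exponential_type_add exponential_type_mult exponential_type_power
          exponential_type_poly exponential_type_const exponential_type_deriv hol type)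
  then obtain A B where AB: "\<And>z. norm (U z - b) \<le> A * exp (B * norm z)"
    unfolding exponential_type_def by auto
  obtain \<alpha> \<beta> where \<alpha>\<beta>: "\<And>z. U z - b = exp (\<alpha> * z + \<beta>)"
    by (rule zero_free_exponential_type[of "\<lambda>z. U z - b", OF _ _ AB])
       (use omit in \<open>auto simp: U_def[symmetric] intro!: holomorphic_intros holU\<close>)
  have Uder: "(U has_field_derivative \<alpha> * exp (\<alpha> * z + \<beta>)) (at z)" for z
  proof -
    have "((\<lambda>z. exp (\<alpha> * z + \<beta>) + b) has_field_derivative \<alpha> * exp (\<alpha> * z + \<beta>)) (at z)"
      by (auto intro!: derivative_eq_intros)
    moreover have "U = (\<lambda>z. exp (\<alpha> * z + \<beta>) + b)"
      using \<alpha>\<beta> by (auto simp: fun_eq_iff algebra_simps)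
    ultimately show ?thesis by simp
  qed
  show ?thesis
  proof (cases "\<exists>z0. v z0 = 0")
    case True
    then obtain z0 where z0: "v z0 = 0" ..
    \<comment> \<open>Because \<open>k \<ge> 2\<close>, both \<open>v ^ k\<close> and its derivative
      vanish at \<open>z0\<close>, and every term of the product rule for \<open>U\<close> contains
      one of them.\<close>
    have "((\<lambda>z. v z ^ k) has_field_derivative 0) (at z0)"
      using \<open>k \<ge> 2\<close> z0 vder[of z0]
      by (auto intro!: derivative_eq_intros)
    then have "(U has_field_derivative 0) (at z0)"
      using DERIV_mult[OF DERIV_mult[OF _ Wder] v'der, of "\<lambda>z. v z ^ k" 0 z0] z0 \<open>k \<ge> 2\<close>
      by (simp add: U_def[abs_def] power_0_left)
    with Uder[of z0] have "\<alpha> = 0"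
      using DERIV_unique by fastforce
    then have "U z - b = U z0 - b" for z
      using \<alpha>\<beta> by simp
    then have U0: "U z = 0" for z
      using z0 \<open>k \<ge> 2\<close> by (simp add: U_def)
    \<comment> \<open>\<open>U\<close> is the derivative of \<open>poly P (v z)\<close>, so this
      composition is constant and \<open>v\<close> takes only finitely many values, the roots of
      \<open>P - [:c:]\<close>.\<close>
    obtain P where P: "pderiv P = monom 1 k * W"
      by (rule polynomial_antiderivative_exists)
    have "((\<lambda>z. poly P (v z)) has_field_derivative 0) (at z)" for z
    proof -
      have "((\<lambda>z. poly P (v z)) has_field_derivative poly (pderiv P) (v z) * deriv v z) (at z)"
        by (rule DERIV_chain2[OF poly_DERIV vder])
      moreover have "poly (pderiv P) (v z) * deriv v z = U z"
        by (simp add: P poly_monom U_def)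
      ultimately show ?thesis using U0[of z] by simp
    qed
    then obtain c where c: "\<And>z. poly P (v z) = c"
      using has_field_derivative_zero_constant[OF convex_UNIV, of "\<lambda>z. poly P (v z)"] by auto
    have "P - [:c:] \<noteq> 0"
    proof
      assume "P - [:c:] = 0"
      then have "pderiv P = 0" by (simp add: pderiv_pCons)
      then show False using P \<open>W \<noteq> 0\<close> by simp
    qed
    then have "finite {w. poly (P - [:c:]) w = 0}" by (rule poly_roots_finite)
    moreover have "range v \<subseteq> {w. poly (P - [:c:]) w = 0}" using c by auto
    ultimately have "finite (range v)" by (rule rev_finite_subset)
    then show ?thesis
      using continuous_finite_range_constant[OF connected_UNIV]
        holomorphic_on_imp_continuous_on[OF hol] by blast
  next
    case False
    obtain A B where "\<And>z. norm (v z) \<le> A * exp (B * norm z)"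
      using type unfolding exponential_type_def by auto
    then obtain c d where cd: "\<And>z. v z = exp (c * z + d)"
      using zero_free_exponential_type[OF hol] False by metis
    show ?thesis
    proof (cases "c = 0")
      case True
      then show ?thesis using cd by (auto simp: constant_on_def)
    next
      case False
      \<comment> \<open>Since \<open>deriv v = c * v\<close>, a point with \<open>v z = w\<close>
        has \<open>U z = b\<close> exactly when \<open>poly R w = 0\<close>. A root is nonzero
        because \<open>poly R 0 = - b\<close>, so the exponential \<open>v\<close> attains
        it.\<close>
      define R where "R = smult c (monom 1 (Suc k) * W) + [:- b:]"
      have Rw: "poly R w = c * w ^ Suc k * poly W w - b" for w
        by (simp add: R_def poly_monom)
      have "degree R > 0"
      proof -
        have "degree (smult c (monom 1 (Suc k) * W)) = Suc k + degree W"
          using False \<open>W \<noteq> 0\<close> by (simp add: degree_mult_eq degree_monom_eq)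
        then show ?thesis
          using degree_add_eq_left[of "[:- b:]" "smult c (monom 1 (Suc k) * W)"] by (simp add: R_def)
      qed
      then obtain w where w: "poly R w = 0"
        using alg_closed_imp_poly_has_root by blast
      with \<open>b \<noteq> 0\<close> have "w \<noteq> 0" by (auto simp: Rw)
      define z where "z = (Ln w - d) / c"
      have vz: "v z = w" using \<open>w \<noteq> 0\<close> False by (simp add: cd z_def)
      have "(v has_field_derivative c * v z) (at z)"
      proof -
        have "((\<lambda>z. exp (c * z + d)) has_field_derivative c * exp (c * z + d)) (at z)"
          by (auto intro!: derivative_eq_intros)
        then show ?thesis using cd by (simp add: cd[abs_def])
      qed
      then have "deriv v z = c * w" by (simp add: DERIV_imp_deriv vz)
      then have "U z = b" using w by (simp add: U_def vz Rw algebra_simps)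
      then show ?thesis using omit by (simp add: U_def)
    qed
  qed
qed

subsection \<open>Rescaling\<close>

text \<open>
  The inequality in \<open>start\<close> says that \<open>\<zeta> \<mapsto> u (a0 + \<sigma>0 ^ (k + 1) * \<zeta>) / \<sigma>0\<close> has spherical derivative
  at least \<open>1\<close> at \<open>0\<close>. Halving \<open>\<sigma>\<close> at a point violating the conclusion cannot go on forever.
\<close>

lemma rescaling_point_exists:
  fixes u :: "complex \<Rightarrow> complex"
  assumes hol: "u holomorphic_on UNIV" and "k \<ge> 1" "\<sigma>0 > 0" "N \<ge> 0"
    and start: "\<sigma>0\<^sup>2 + (norm (u a0))\<^sup>2 \<le> \<sigma>0 ^ (k + 2) * norm (deriv u a0)"
  obtains a \<sigma> where "0 < \<sigma>" "\<sigma> \<le> \<sigma>0"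
    "\<sigma>\<^sup>2 + (norm (u a))\<^sup>2 \<le> \<sigma> ^ (k + 2) * norm (deriv u a)"
    "\<And>a'. dist a a' \<le> N * \<sigma> ^ (k + 1) \<Longrightarrow>
        (\<sigma> / 2) ^ (k + 2) * norm (deriv u a') < (\<sigma> / 2)\<^sup>2 + (norm (u a'))\<^sup>2"
proof (rule ccontr)
  assume none: "\<not> thesis"
  define \<sigma> where "\<sigma> n = \<sigma>0 / 2 ^ n" for n :: nat
  have \<sigma>pos: "\<sigma> n > 0" and \<sigma>le: "\<sigma> n \<le> \<sigma>0" and \<sigma>Suc: "\<sigma> (Suc n) = \<sigma> n / 2" for n
    using \<open>\<sigma>0 > 0\<close> by (auto simp: \<sigma>_def divide_le_eq mult_le_cancel_left1)
  \<comment> \<open>If the conclusion fails at \<open>(a n, \<sigma> n)\<close>, a nearby point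
    satisfies the starting inequality with \<open>\<sigma> n / 2\<close>, and the choice
    repeats.\<close>
  have "\<exists>a. \<forall>n. ((\<sigma> n)\<^sup>2 + (norm (u (a n)))\<^sup>2 \<le> \<sigma> n ^ (k + 2) * norm (deriv u (a n))) \<and>
      dist (a n) (a (Suc n)) \<le> N * \<sigma> n ^ (k + 1)"
  proof (rule dependent_nat_choice)
    show "\<exists>a. (\<sigma> 0)\<^sup>2 + (norm (u a))\<^sup>2 \<le> \<sigma> 0 ^ (k + 2) * norm (deriv u a)"
      using start by (auto simp: \<sigma>_def)
  next
    fix a n
    assume "(\<sigma> n)\<^sup>2 + (norm (u a))\<^sup>2 \<le> \<sigma> n ^ (k + 2) * norm (deriv u a)"
    then have "\<exists>a'. dist a a' \<le> N * \<sigma> n ^ (k + 1) \<and>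
        \<not> (\<sigma> n / 2) ^ (k + 2) * norm (deriv u a') < (\<sigma> n / 2)\<^sup>2 + (norm (u a'))\<^sup>2"
      using that[of "\<sigma> n" a] none \<sigma>pos \<sigma>le by blast
    then show "\<exists>a'. (\<sigma> (Suc n))\<^sup>2 + (norm (u a'))\<^sup>2 \<le> \<sigma> (Suc n) ^ (k + 2) * norm (deriv u a') \<and>
        dist a a' \<le> N * \<sigma> n ^ (k + 1)"
      by (auto simp: \<sigma>Suc not_less)
  qed
  then obtain a where a: "\<And>n. (\<sigma> n)\<^sup>2 + (norm (u (a n)))\<^sup>2 \<le> \<sigma> n ^ (k + 2) * norm (deriv u (a n))"
    and step: "\<And>n. dist (a n) (a (Suc n)) \<le> N * \<sigma> n ^ (k + 1)"
    by blast
  \<comment> \<open>The steps are dominated by a geometric series, so \<open>a\<close> converges and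
    \<open>deriv u (a n)\<close> stays bounded.\<close>
  have "summable (\<lambda>n. a (Suc n) - a n)"
  proof (rule summable_comparison_test')
    show "summable (\<lambda>n. N * \<sigma>0 ^ (k + 1) * (1 / 2) ^ n)"
      by (intro summable_mult summable_geometric) auto
    fix n
    have "((1/2::real) ^ n) ^ (k + 1) \<le> ((1/2) ^ n) ^ 1"
      by (intro power_decreasing) (auto simp: power_le_one)
    then have "\<sigma>0 ^ (k + 1) * ((1/2) ^ n) ^ (k + 1) \<le> \<sigma>0 ^ (k + 1) * (1/2) ^ n"
      using \<open>\<sigma>0 > 0\<close> by (intro mult_left_mono) auto
    also have "\<sigma>0 ^ (k + 1) * ((1/2) ^ n) ^ (k + 1) = \<sigma> n ^ (k + 1)"
      unfolding power_mult_distrib[symmetric] by (simp add: \<sigma>_def power_one_over)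
    finally have "N * \<sigma> n ^ (k + 1) \<le> N * (\<sigma>0 ^ (k + 1) * (1/2) ^ n)"
      using \<open>N \<ge> 0\<close> by (intro mult_left_mono)
    with step[of n] show "norm (a (Suc n) - a n) \<le> N * \<sigma>0 ^ (k + 1) * (1 / 2) ^ n"
      by (simp add: dist_norm norm_minus_commute mult.assoc)
  qed
  then have "convergent (\<lambda>n. (a n - a 0) + a 0)"
    by (intro convergent_add convergent_const) (simp add: summable_iff_convergent sum_lessThan_telescope)
  then obtain l where l: "a \<longlonglongrightarrow> l"
    by (auto simp: convergent_def)
  have \<sigma>_lim: "\<sigma> \<longlonglongrightarrow> 0"
    unfolding \<sigma>_def by real_asymp
  have "isCont (deriv u) l"
    using holomorphic_deriv[OF hol open_UNIV] holomorphic_on_imp_continuous_on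
      continuous_on_eq_continuous_at by blast
  then have "(\<lambda>n. deriv u (a n)) \<longlonglongrightarrow> deriv u l"
    using l by (rule isCont_tendsto_compose)
  then have "(\<lambda>n. \<sigma> n ^ k * norm (deriv u (a n))) \<longlonglongrightarrow> 0 ^ k * norm (deriv u l)"
    by (intro tendsto_intros \<sigma>_lim)
  \<comment> \<open>Dividing the starting inequality by \<open>(\<sigma> n)\<^sup>2\<close> gives a
    lower bound for a sequence that tends to \<open>0\<close>.\<close>
  moreover have "1 \<le> \<sigma> n ^ k * norm (deriv u (a n))" for n
  proof -
    have "(\<sigma> n)\<^sup>2 * 1 \<le> (\<sigma> n)\<^sup>2 + (norm (u (a n)))\<^sup>2" by simp
    also have "\<dots> \<le> (\<sigma> n)\<^sup>2 * (\<sigma> n ^ k * norm (deriv u (a n)))"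
      using a[of n] by (simp add: power_add mult_ac power2_eq_square)
    finally show ?thesis
      by (rule mult_left_le_imp_le) (use \<sigma>pos[of n] in simp)
  qed
  ultimately have "1 \<le> 0 ^ k * norm (deriv u l)"
    by (intro LIMSEQ_le_const) auto
  then show False using \<open>k \<ge> 1\<close> by (simp add: power_0_left)
qed

text \<open>Bridges the growth bounds, valid on a compact set only for large \<open>n\<close>, and
  Montel's theorem, which wants the whole sequence bounded.\<close>

lemma bounded_from_index_imp_bounded:
  fixes F :: "nat \<Rightarrow> complex \<Rightarrow> complex"
  assumes "compact K" and cont: "\<And>n. continuous_on K (F n)"
    and bound: "\<And>n z. n \<ge> N \<Longrightarrow> z \<in> K \<Longrightarrow> norm (F n z) \<le> D"
  obtains B where "\<And>n z. z \<in> K \<Longrightarrow> norm (F n z) \<le> B"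
proof -
  have "bounded (\<Union>n<N. F n ` K)"
    using assms by (intro bounded_UN ballI compact_imp_bounded compact_continuous_image) auto
  then obtain B where B: "\<And>x. x \<in> (\<Union>n<N. F n ` K) \<Longrightarrow> norm x \<le> B"
    by (auto simp: bounded_iff)
  have "norm (F n z) \<le> max B D" if "z \<in> K" for n z
    using that B[of "F n z"] bound[of n z] by (cases "n < N") force+
  then show ?thesis by (rule that)
qed

text \<open>The exponent \<open>k + 1\<close> in the scaling makes
  \<open>v n ^ k * deriv (v n)\<close> equal to \<open>u ^ k * deriv u\<close> at the corresponding
  point. As \<open>s n * v n\<close> tends to \<open>0\<close>, \<open>poly W 0 \<noteq> 0\<close>
  keeps the polynomial factor from degenerating in the limit.\<close>

lemma entire_omitting_imp_constant_nonzero_at_0: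
  fixes u :: "complex \<Rightarrow> complex"
  assumes hol: "u holomorphic_on UNIV"
    and W0: "poly W 0 \<noteq> 0" and "k \<ge> 2" "b \<noteq> 0"
    and omit: "\<And>z. u z ^ k * poly W (u z) * deriv u z \<noteq> b"
  shows "u constant_on UNIV"
proof (cases "\<exists>\<sigma>>0. \<forall>a. \<sigma> ^ (k + 2) * norm (deriv u a) \<le> \<sigma>\<^sup>2 + (norm (u a))\<^sup>2")
  case True
  then obtain \<sigma> where \<sigma>: "\<sigma> > 0" "\<And>a. \<sigma> ^ (k + 2) * norm (deriv u a) \<le> \<sigma>\<^sup>2 + (norm (u a))\<^sup>2"
    by blast
  define C where "C = (1 + \<sigma>\<^sup>2) / \<sigma> ^ (k + 2)"
  define M where "M = max 1 (norm (u 0))"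
  have "norm (deriv u a) \<le> C * (1 + (norm (u a))\<^sup>2)" for a
  proof -
    have "\<sigma> ^ (k + 2) * norm (deriv u a) \<le> (1 + \<sigma>\<^sup>2) * (1 + (norm (u a))\<^sup>2)"
    proof -
      have "0 \<le> \<sigma>\<^sup>2 * (norm (u a))\<^sup>2" by simp
      moreover have "(1 + \<sigma>\<^sup>2) * (1 + (norm (u a))\<^sup>2) =
          (\<sigma>\<^sup>2 + (norm (u a))\<^sup>2) + (1 + \<sigma>\<^sup>2 * (norm (u a))\<^sup>2)"
        by (simp add: algebra_simps)
      ultimately show ?thesis using \<sigma>(2)[of a] by linarith
    qed
    then show ?thesis using \<sigma>(1) by (simp add: C_def field_simps)
  qed
  moreover have "C \<ge> 0" using \<sigma>(1) by (simp add: C_def)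
  ultimately have "norm (u z) \<le> M * exp (4 * C * M * norm z)" for z
    by (intro spherical_derivative_bound_imp_exponential_growth[OF hol, where R = "norm z"])
       (auto simp: M_def)
  then have "exponential_type u" by (rule exponential_typeI)
  then show ?thesis
    using exponential_type_omitting_imp_constant[OF hol _ _ \<open>k \<ge> 2\<close> \<open>b \<noteq> 0\<close> omit] W0 by force
next
  case False
  \<comment> \<open>After rescaling, the radius becomes \<open>n + 4\<close>: enough for the radius
    \<open>n\<close> in the growth bound and for the radius \<open>2\<close> in the bound at
    \<open>0\<close>, even when \<open>n = 0\<close>.\<close>
  have ex: "\<exists>a \<sigma>. 0 < \<sigma> \<and> \<sigma> \<le> 1 / real (Suc n) \<and>
      \<sigma>\<^sup>2 + (norm (u a))\<^sup>2 \<le> \<sigma> ^ (k + 2) * norm (deriv u a) \<and>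
      (\<forall>a'. dist a a' \<le> (real n + 4) * \<sigma> ^ (k + 1) \<longrightarrow>
        (\<sigma> / 2) ^ (k + 2) * norm (deriv u a') < (\<sigma> / 2)\<^sup>2 + (norm (u a'))\<^sup>2)" for n :: nat
  proof -
    obtain a0 where a0: "(1 / Suc n)\<^sup>2 + (norm (u a0))\<^sup>2 \<le> (1 / Suc n) ^ (k + 2) * norm (deriv u a0)"
      using False[simplified not_ex not_all not_le de_Morgan_conj, THEN spec, of "1 / Suc n"]
      by (auto simp: not_le intro: less_imp_le)
    have "1 \<le> k" "0 < 1 / real (Suc n)" "0 \<le> real n + 4"
      using \<open>k \<ge> 2\<close> by auto
    from rescaling_point_exists[OF hol this a0] show ?thesis
      by metis
  qed
  then obtain a s where s: "\<And>n. 0 < s n" "\<And>n. s n \<le> 1 / Suc n"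
    and \<Phi>: "\<And>n. (s n)\<^sup>2 + (norm (u (a n)))\<^sup>2 \<le> s n ^ (k + 2) * norm (deriv u (a n))"
    and near: "\<And>n a'. dist (a n) a' \<le> (real n + 4) * s n ^ (k + 1) \<Longrightarrow>
        (s n / 2) ^ (k + 2) * norm (deriv u a') < (s n / 2)\<^sup>2 + (norm (u a'))\<^sup>2"
    by metis
  define h where "h n z = a n + of_real (s n ^ (k + 1)) * z" for n z
  define v where "v n z = u (h n z) / of_real (s n)" for n z
  have uder: "(u has_field_derivative deriv u z) (at z)" for z
    using hol by (auto intro: holomorphic_derivI)
  have hder: "(h n has_field_derivative of_real (s n ^ (k + 1))) (at z)" for n z
    unfolding h_def[abs_def] by (auto intro!: derivative_eq_intros)
  have vder: "(v n has_field_derivative of_real (s n ^ k) * deriv u (h n z)) (at z)" for n z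
  proof -
    have "(v n has_field_derivative deriv u (h n z) * of_real (s n ^ (k + 1)) / of_real (s n)) (at z)"
      unfolding v_def[abs_def]
      by (intro DERIV_cdivide DERIV_chain2[where f = u and g = "h n", OF uder hder])
    moreover have "deriv u (h n z) * of_real (s n ^ (k + 1)) / of_real (s n) =
        of_real (s n ^ k) * deriv u (h n z)"
      using s(1)[of n] by simp
    ultimately show ?thesis by (simp only:)
  qed
  have deriv_v: "deriv (v n) z = of_real (s n ^ k) * deriv u (h n z)" for n z
    by (rule DERIV_imp_deriv[OF vder])
  have holv: "v n holomorphic_on UNIV" for n
    using vder by (auto simp: holomorphic_on_def field_differentiable_def)
  \<comment> \<open>\<open>2 ^ (k + 2)\<close> is the price of \<open>s n / 2\<close> in
    \<open>near\<close>; \<open>M\<close> is the bound \<open>max 1 (8 * C)\<close> for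
    \<open>v n 0\<close>.\<close>
  define C :: real where "C = 2 ^ (k + 2)"
  define M where "M = 8 * C"
  have C: "C \<ge> 1" unfolding C_def by (rule one_le_power) simp
  have v'le: "norm (deriv (v n) z) \<le> C * (1 + (norm (v n z))\<^sup>2)" if "norm z \<le> n + 4" for n z
  proof -
    have sn: "s n > 0" by (rule s)
    have "dist (a n) (h n z) = norm z * s n ^ (k + 1)"
      using sn by (simp add: h_def dist_norm norm_mult norm_power)
    also have "\<dots> \<le> (real n + 4) * s n ^ (k + 1)"
      using that sn by (intro mult_right_mono) auto
    finally have "(s n / 2) ^ (k + 2) * norm (deriv u (h n z)) < (s n / 2)\<^sup>2 + (norm (u (h n z)))\<^sup>2"
      by (rule near)
    also have "norm (u (h n z)) = s n * norm (v n z)"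
      using sn by (simp add: v_def norm_divide)
    also have "(s n / 2) ^ (k + 2) * norm (deriv u (h n z)) = (s n)\<^sup>2 * (norm (deriv (v n) z) / C)"
      using sn by (simp add: deriv_v norm_mult norm_power C_def power_divide power_add power2_eq_square)
    also have "(s n / 2)\<^sup>2 + (s n * norm (v n z))\<^sup>2 = (s n)\<^sup>2 * (1 / 4 + (norm (v n z))\<^sup>2)"
      by (simp add: power_mult_distrib power_divide algebra_simps)
    finally have "norm (deriv (v n) z) / C < 1 / 4 + (norm (v n z))\<^sup>2"
      by (rule mult_left_less_imp_less) simp
    then have "norm (deriv (v n) z) / C \<le> 1 + (norm (v n z))\<^sup>2"
      by linarith
    then show ?thesis using C by (simp add: divide_le_eq mult.commute)
  qed
  have v'ge: "1 + (norm (v n 0))\<^sup>2 \<le> norm (deriv (v n) 0)" for n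
  proof -
    have sn: "s n > 0" by (rule s)
    have "(s n)\<^sup>2 * (1 + (norm (v n 0))\<^sup>2) = (s n)\<^sup>2 + (norm (u (a n)))\<^sup>2"
      using sn by (simp add: v_def h_def norm_divide power_divide field_simps)
    also have "\<dots> \<le> (s n)\<^sup>2 * norm (deriv (v n) 0)"
      using \<Phi>[of n] sn by (simp add: deriv_v h_def norm_mult norm_power power_add mult_ac power2_eq_square)
    finally show ?thesis using sn by simp
  qed
  have "norm (v n 0) \<le> max 1 (8 * C)" for n
    by (rule spherical_derivative_ge_1_imp_bounded[OF holv])
       (use C v'ge in \<open>auto intro!: v'le\<close>)
  then have v0: "norm (v n 0) \<le> M" for n
    using C by (simp add: M_def)
  have growth: "norm (v n z) \<le> M * exp (4 * C * M * norm z)" if "2 * norm z \<le> n" for n z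
    by (rule spherical_derivative_bound_imp_exponential_growth[OF holv _ v0, where R = "real n / 2"])
       (use C that in \<open>auto simp: M_def intro!: v'le\<close>)
  define U where "U n z = v n z ^ k * poly W (of_real (s n) * v n z) * deriv (v n) z" for n z
  have U: "U n z \<noteq> b" for n z
  proof -
    have "U n z = u (h n z) ^ k * poly W (u (h n z)) * deriv u (h n z)"
      using s(1)[of n] by (simp add: U_def v_def deriv_v power_divide)
    then show ?thesis using omit by simp
  qed
  have holU: "U n holomorphic_on UNIV" for n
  proof -
    have "((\<lambda>z. poly W (of_real (s n) * v n z)) has_field_derivative
        poly (pderiv W) (of_real (s n) * v n z) * (of_real (s n) * deriv (v n) z)) (at z)" for z
      unfolding deriv_v by (rule DERIV_chain2[OF poly_DERIV DERIV_cmult[OF vder]])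
    then have "(\<lambda>z. poly W (of_real (s n) * v n z)) holomorphic_on UNIV"
      by (auto simp: holomorphic_on_def field_differentiable_def)
    then show ?thesis
      unfolding U_def[abs_def] by (intro holomorphic_intros holv holomorphic_deriv) auto
  qed
  have v_bd: "\<exists>N D. \<forall>n\<ge>N. \<forall>z\<in>K. norm (v n z) \<le> D \<and> norm (U n z) \<le> D" if K: "compact K" for K
  proof -
    obtain R where R: "\<And>z. z \<in> K \<Longrightarrow> norm z \<le> R"
      using compact_imp_bounded[OF K] by (auto simp: bounded_iff)
    define D where "D = M * exp (4 * C * M * R)"
    obtain N :: nat where N: "2 * R \<le> N" using real_arch_simple by blast
    \<comment> \<open>Since \<open>s n \<le> 1\<close>, the argument of \<open>W\<close> in
      \<open>U n\<close> stays in this disc.\<close>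
    have "compact (poly W ` cball 0 D)"
      by (intro compact_continuous_image continuous_intros) auto
    then obtain E where E: "\<And>w. norm w \<le> D \<Longrightarrow> norm (poly W w) \<le> E"
      using compact_imp_bounded by (fastforce simp: bounded_iff)
    have vU: "norm (v n z) \<le> D" "norm (U n z) \<le> D ^ k * E * (C * (1 + D\<^sup>2))" if "n \<ge> N" "z \<in> K" for n z
    proof -
      have z: "2 * norm z \<le> n" "norm z \<le> R" using R[OF that(2)] N that(1) by auto
      have "norm (v n z) \<le> M * exp (4 * C * M * norm z)" by (rule growth[OF z(1)])
      also have "\<dots> \<le> D"
        unfolding D_def using z(2) C by (intro mult_left_mono) (auto simp: M_def)
      finally show v: "norm (v n z) \<le> D" .
      have "s n \<le> 1" using s(2)[of n] by (smt (verit) divide_le_eq_1 of_nat_0_less_iff of_nat_Suc of_nat_0_le_iff)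
      then have "s n * norm (v n z) \<le> 1 * D"
        using v s(1)[of n] by (intro mult_mono) auto
      then have p: "norm (poly W (of_real (s n) * v n z)) \<le> E"
        using s(1)[of n] by (intro E) (simp add: norm_mult)
      have "norm (deriv (v n) z) \<le> C * (1 + (norm (v n z))\<^sup>2)"
        using z(1) by (intro v'le) auto
      also have "\<dots> \<le> C * (1 + D\<^sup>2)"
        using v C by (intro mult_left_mono add_left_mono power_mono) auto
      finally have "norm (deriv (v n) z) \<le> C * (1 + D\<^sup>2)" .
      moreover have "D \<ge> 0" "E \<ge> 0"
        using v p norm_ge_zero order_trans by blast+
      ultimately show "norm (U n z) \<le> D ^ k * E * (C * (1 + D\<^sup>2))"
        unfolding U_def norm_mult norm_power using v p
        by (intro mult_mono power_mono) auto
    qed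
    then have "\<forall>n\<ge>N. \<forall>z\<in>K. norm (v n z) \<le> max D (D ^ k * E * (C * (1 + D\<^sup>2))) \<and>
        norm (U n z) \<le> max D (D ^ k * E * (C * (1 + D\<^sup>2)))"
      by (meson max.coboundedI1 max.coboundedI2)
    then show ?thesis by blast
  qed
  have v_bd': "\<exists>B. \<forall>h\<in>range v. \<forall>z\<in>K. norm (h z) \<le> B" if K: "compact K" for K
  proof -
    obtain N D where "\<And>n z. n \<ge> N \<Longrightarrow> z \<in> K \<Longrightarrow> norm (v n z) \<le> D"
      using v_bd[OF K] by metis
    then obtain B where "\<And>n z. z \<in> K \<Longrightarrow> norm (v n z) \<le> B"
      using bounded_from_index_imp_bounded[OF K, of v]
        holomorphic_on_imp_continuous_on[OF holomorphic_on_subset[OF holv subset_UNIV]] by metis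
    then show ?thesis by auto
  qed
  have U_bd': "\<exists>B. \<forall>h\<in>range U. \<forall>z\<in>K. norm (h z) \<le> B" if K: "compact K" for K
  proof -
    obtain N D where "\<And>n z. n \<ge> N \<Longrightarrow> z \<in> K \<Longrightarrow> norm (U n z) \<le> D"
      using v_bd[OF K] by metis
    then obtain B where "\<And>n z. z \<in> K \<Longrightarrow> norm (U n z) \<le> B"
      using bounded_from_index_imp_bounded[OF K, of U]
        holomorphic_on_imp_continuous_on[OF holomorphic_on_subset[OF holU subset_UNIV]] by metis
    then show ?thesis by auto
  qed
  \<comment> \<open>Montel is applied twice, to \<open>v\<close> and then to \<open>U\<close> along
    the first subsequence, so that both converge along \<open>r\<close>.\<close>
  obtain g r1 where g: "g holomorphic_on UNIV" "strict_mono r1"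
      "\<And>x. (\<lambda>n. v (r1 n) x) \<longlonglongrightarrow> g x"
      "\<And>K. compact K \<Longrightarrow> uniform_limit K (v \<circ> r1) g sequentially"
    by (rule Montel[of UNIV "range v" v]) (use holv v_bd' in auto)
  obtain G r2 where G: "G holomorphic_on UNIV" "strict_mono r2"
      "\<And>x. (\<lambda>n. U (r1 (r2 n)) x) \<longlonglongrightarrow> G x"
      "\<And>K. compact K \<Longrightarrow> uniform_limit K ((\<lambda>n. U (r1 n)) \<circ> r2) G sequentially"
    by (rule Montel[of UNIV "range U" "\<lambda>n. U (r1 n)"]) (use holU U_bd' in auto)
  define r where "r n = r1 (r2 n)" for n
  have "strict_mono r" using g(2) G(2) by (auto simp: r_def strict_mono_def)
  have v_lim: "(\<lambda>n. v (r n) z) \<longlonglongrightarrow> g z" for z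
    unfolding r_def using LIMSEQ_subseq_LIMSEQ[OF g(3) G(2)] by (simp add: o_def)
  have v'_lim: "(\<lambda>n. deriv (v (r n)) z) \<longlonglongrightarrow> deriv g z" for z
  proof -
    have "uniform_limit (ball z 1) (v \<circ> r1) g sequentially"
      by (rule uniform_limit_on_subset[OF g(4)[OF compact_cball[of z 1]]]) auto
    then have "(\<lambda>n. deriv ((v \<circ> r1) n) z) \<longlonglongrightarrow> deriv g z"
      by (rule deriv_complex_uniform_limit)
         (auto intro!: always_eventually holomorphic_on_subset[OF holv])
    then show ?thesis
      unfolding r_def using LIMSEQ_subseq_LIMSEQ[OF _ G(2)] by (fastforce simp: o_def)
  qed
  have s_lim: "(\<lambda>n. s (r n)) \<longlonglongrightarrow> 0"
  proof -
    have "s \<longlonglongrightarrow> 0"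
      by (rule tendsto_sandwich[of "\<lambda>_. 0", OF _ _ tendsto_const LIMSEQ_Suc[OF lim_1_over_n]])
         (use s in \<open>auto intro!: always_eventually less_imp_le\<close>)
    then show ?thesis using LIMSEQ_subseq_LIMSEQ[OF _ \<open>strict_mono r\<close>] by (fastforce simp: o_def)
  qed
  have G_eq: "G z = g z ^ k * poly [:poly W 0:] (g z) * deriv g z" for z
  proof -
    have "(\<lambda>n. of_real (s (r n)) * v (r n) z) \<longlonglongrightarrow> of_real 0 * g z"
      by (intro tendsto_intros s_lim v_lim)
    then have W_lim: "(\<lambda>n. poly W (of_real (s (r n)) * v (r n) z)) \<longlonglongrightarrow> poly W 0"
      by (intro isCont_tendsto_compose[of 0 "poly W"]) simp_all
    have "(\<lambda>n. U (r n) z) \<longlonglongrightarrow> g z ^ k * poly W 0 * deriv g z"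
      unfolding U_def by (intro tendsto_mult tendsto_power W_lim v_lim v'_lim)
    then show ?thesis
      using G(3)[of z] LIMSEQ_unique by (auto simp: r_def)
  qed
  \<comment> \<open>By Hurwitz a nonconstant \<open>G\<close> omits \<open>b\<close>. A constant
    \<open>G\<close> omits \<open>b\<close> or \<open>2 * b\<close>, which differ.\<close>
  obtain b' where b': "b' \<noteq> 0" "\<And>z. G z \<noteq> b'"
  proof (cases "\<exists>c. \<forall>z. G z = c")
    case True
    then obtain c where "\<And>z. G z = c" by blast
    then show ?thesis using that[of b] that[of "2 * b"] \<open>b \<noteq> 0\<close> by force
  next
    case False
    have "G z - b \<noteq> 0" for z
    proof (rule Hurwitz_no_zeros[of UNIV "\<lambda>n z. U (r n) z - b" "\<lambda>z. G z - b"])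
      show "\<not> (\<lambda>z. G z - b) constant_on UNIV"
      proof
        assume "(\<lambda>z. G z - b) constant_on UNIV"
        then obtain c where "\<And>z. G z - b = c" by (auto simp: constant_on_def)
        then have "G z = c + b" for z by (simp add: algebra_simps flip: \<open>\<And>z. G z - b = c\<close>)
        with False show False by blast
      qed
      show "uniform_limit K (\<lambda>n z. U (r n) z - b) (\<lambda>z. G z - b) sequentially" if "compact K" for K
        using G(4)[OF that] by (intro uniform_limit_intros) (simp add: o_def r_def)
    qed (use U G(1) holU in \<open>auto intro!: holomorphic_intros\<close>)
    then show ?thesis using that[of b] \<open>b \<noteq> 0\<close> by auto
  qed
  have "norm (g z) \<le> M * exp (4 * C * M * norm z)" for z
  proof (rule tendsto_upperbound[OF tendsto_norm[OF v_lim]])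
    obtain N :: nat where N: "2 * norm z \<le> N" using real_arch_simple by blast
    have "2 * norm z \<le> r n" if "n \<ge> N" for n
      using that N seq_suble[OF \<open>strict_mono r\<close>, of n] by linarith
    then show "\<forall>\<^sub>F n in sequentially. norm (v (r n) z) \<le> M * exp (4 * C * M * norm z)"
      using growth by (auto simp: eventually_sequentially intro!: exI[of _ N])
  qed auto
  then have "exponential_type g" by (rule exponential_typeI)
  then have "g constant_on UNIV"
    using exponential_type_omitting_imp_constant[OF g(1) _ _ \<open>k \<ge> 2\<close> b'(1), of "[:poly W 0:]"]
      b'(2) W0 unfolding G_eq by auto
  then obtain c where "g = (\<lambda>_. c)" by (auto simp: constant_on_def fun_eq_iff)
  then have "deriv g 0 = 0" by simp
  \<comment> \<open>The normalisation \<open>v'ge\<close> survives in the limit and rules out a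
    constant \<open>g\<close>.\<close>
  moreover have "1 \<le> norm (deriv g 0)"
  proof (rule tendsto_lowerbound[OF tendsto_norm[OF v'_lim]])
    have "1 \<le> norm (deriv (v n) 0)" for n
      using v'ge[of n] zero_le_power2[of "norm (v n 0)"] by linarith
    then show "\<forall>\<^sub>F n in sequentially. 1 \<le> norm (deriv (v (r n)) 0)" by simp
  qed auto
  ultimately show ?thesis by simp
qed

text \<open>The zero of \<open>W\<close> at \<open>0\<close> is split off and its multiplicity added
  to \<open>k\<close>, which stays at least \<open>2\<close>.\<close>

lemma entire_omitting_imp_constant:
  fixes u :: "complex \<Rightarrow> complex"
  assumes hol: "u holomorphic_on UNIV"
    and "W \<noteq> 0" "k \<ge> 2" "b \<noteq> 0"
    and omit: "\<And>z. u z ^ k * poly W (u z) * deriv u z \<noteq> b"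
  shows "u constant_on UNIV"
proof -
  obtain V where V: "W = [:-0, 1:] ^ order 0 W * V" "\<not> [:-0, 1:] dvd V"
    using order_decomp[OF \<open>W \<noteq> 0\<close>, of 0] by blast
  have "poly W w = w ^ order 0 W * poly V w" for w
    by (subst V(1)) simp
  then have "u z ^ (k + order 0 W) * poly V (u z) * deriv u z \<noteq> b" for z
    using omit[of z] by (simp add: power_add mult_ac)
  moreover have "poly V 0 \<noteq> 0"
    using V(2) by (simp add: poly_eq_0_iff_dvd)
  ultimately show ?thesis
    using entire_omitting_imp_constant_nonzero_at_0[OF hol, of V "k + order 0 W" b] \<open>k \<ge> 2\<close> \<open>b \<noteq> 0\<close> by auto
qed

subsection \<open>Several variables\<close>

lemma bounded_linear_vector_scalar_mult_left:
  "bounded_linear (\<lambda>c. c *s (v :: complex ^ 'n))"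
  unfolding linear_conv_bounded_linear[symmetric]
  by (auto intro!: linearI simp: vec_eq_iff algebra_simps)

text \<open>Each partial derivative is \<open>L\<close> at a basis vector, and complex linearity
  assembles them into \<open>L w\<close>.\<close>

lemma total_deriv_eq_derivative:
  assumes f: "(f has_derivative L) (at w)" and L: "\<And>c v. L (c *s v) = c * L v"
  shows "total_deriv f w = L w"
proof -
  have "partial_deriv j f w = L (axis j 1)" for j
  proof -
    let ?g = "\<lambda>x. w + (x - w $ j) *s axis j 1"
    have g: "(\<chi> i. if i = j then x else w $ i) = ?g x" for x
      by (simp add: vec_eq_iff axis_def)
    have "(?g has_derivative (\<lambda>h. h *s axis j 1)) (at (w $ j))"
      by (auto intro!: derivative_eq_intros
            bounded_linear.has_derivative[OF bounded_linear_vector_scalar_mult_left])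
    moreover have "(f has_derivative L) (at (?g (w $ j)))"
      using f by simp
    ultimately have "((\<lambda>x. f (?g x)) has_derivative (\<lambda>h. L (h *s axis j 1))) (at (w $ j))"
      by (rule has_derivative_compose)
    then have "((\<lambda>x. f (?g x)) has_field_derivative L (axis j 1)) (at (w $ j))"
      by (simp add: has_field_derivative_def L mult.commute[of _ "L _"])
    then show ?thesis
      unfolding partial_deriv_def g by (rule DERIV_imp_deriv)
  qed
  then have "total_deriv f w = (\<Sum>j\<in>UNIV. L (w $ j *s axis j 1))"
    by (simp add: total_deriv_def L)
  also have "\<dots> = L (\<Sum>j\<in>UNIV. w $ j *s axis j 1)"
    using has_derivative_linear[OF f] by (simp add: linear_sum)
  also have "\<dots> = L w" by (simp add: basis_expansion)
  finally show ?thesis .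
qed

text \<open>The curve \<open>exp s *s z\<close> is its own derivative, so the chain rule evaluates
  the Frechet derivative in the direction of the base point itself.\<close>

lemma entire_exp_line_derivative:
  assumes "entire f"
  shows "((\<lambda>s. f (exp s *s z)) has_field_derivative total_deriv f (exp s *s z)) (at s)"
proof -
  obtain L where f: "(f has_derivative L) (at (exp s *s z))" and L: "\<And>c v. L (c *s v) = c * L v"
    using assms unfolding entire_def by blast
  have "((\<lambda>s. exp s *s z) has_derivative (\<lambda>h. (exp s * h) *s z)) (at s)"
    by (auto intro!: derivative_eq_intros
          bounded_linear.has_derivative[OF bounded_linear_vector_scalar_mult_left])
  then have "((\<lambda>s. f (exp s *s z)) has_derivative (\<lambda>h. L ((exp s * h) *s z))) (at s)"
    using f by (rule has_derivative_compose)
  moreover have "L ((exp s * h) *s z) = total_deriv f (exp s *s z) * h" for h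
    unfolding total_deriv_eq_derivative[OF f L] by (simp add: L)
  ultimately show ?thesis
    by (simp add: has_field_derivative_def)
qed

theorem theorem2p3:
  fixes f :: "complex ^ 'n \<Rightarrow> complex" and b :: complex and k :: nat
  assumes "entire f"
    and "b \<noteq> 0"
    and "k \<ge> 2"
    and "\<exists>(Q :: complex poly) m. degree Q = m \<and> m \<ge> 1 \<and>
           (\<forall>z. f z ^ k * poly Q (f z) * total_deriv f z \<noteq> b)"
  shows "f constant_on UNIV"
proof -
  obtain Q :: "complex poly" where "degree Q \<ge> 1"
    and omit: "\<And>z. f z ^ k * poly Q (f z) * total_deriv f z \<noteq> b"
    using assms(4) by blast
  then have "Q \<noteq> 0" by auto
  have "f z = f 0" for z
  proof -
    define u where "u s = f (exp s *s z)" for s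
    have uder: "(u has_field_derivative total_deriv f (exp s *s z)) (at s)" for s
      unfolding u_def by (rule entire_exp_line_derivative[OF assms(1)])
    then have "u holomorphic_on UNIV"
      by (auto simp: holomorphic_on_def field_differentiable_def)
    moreover have "u s ^ k * poly Q (u s) * deriv u s \<noteq> b" for s
      using omit[of "exp s *s z"] DERIV_imp_deriv[OF uder[of s]] by (simp add: u_def)
    ultimately have "u constant_on UNIV"
      using entire_omitting_imp_constant[OF _ \<open>Q \<noteq> 0\<close> \<open>k \<ge> 2\<close> \<open>b \<noteq> 0\<close>] by blast
    then have u0: "u s = f z" for s
      by (metis UNIV_I constant_on_def exp_zero u_def vector_smult_lid)
    \<comment> \<open>\<open>exp s\<close> is never \<open>0\<close>, so the origin is reached only
      as a limit along \<open>s = - n\<close>; continuity of \<open>f\<close> at \<open>0\<close>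
      gives \<open>f z = f 0\<close>.\<close>
    have "(\<lambda>n. of_real (exp (- real n)) *s z) \<longlonglongrightarrow> 0"
    proof (rule vec_tendstoI)
      fix i
      have "(\<lambda>n. exp (- real n)) \<longlonglongrightarrow> 0" by real_asymp
      then have "(\<lambda>n. of_real (exp (- real n)) * z $ i) \<longlonglongrightarrow> of_real 0 * z $ i"
        by (intro tendsto_intros)
      then show "(\<lambda>n. (of_real (exp (- real n)) *s z) $ i) \<longlonglongrightarrow> 0 $ i" by simp
    qed
    moreover have "isCont f 0"
      using assms(1) by (auto simp: entire_def intro: has_derivative_continuous)
    ultimately have "(\<lambda>n. f (of_real (exp (- real n)) *s z)) \<longlonglongrightarrow> f 0"
      by (rule isCont_tendsto_compose[rotated])
    moreover have "f (of_real (exp (- real n)) *s z) = f z" for n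
      using u0[of "of_real (- real n)"] unfolding u_def exp_of_real .
    ultimately show ?thesis
      by (simp add: LIMSEQ_const_iff)
  qed
  then show ?thesis by (auto simp: constant_on_def)
qed

end
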